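(* Let $G=\mathrm{PGL}(2,q)$ with $q>2$ a power of $2$, let $2k+1=q^2-1$ denote the odd part of $|G|$, and let $1\ne h\in G$ have odd order. If $g\in G$ satisfies $[h,h^g]\ne 1$, then either $[h,h^g]$ or $(hh^g)^kh$ is an involution.
   Context: $h^g=g^{-1}hg$, and $[x,y]=x^{-1}y^{-1}xy$. An involution is an element of order exactly $2$. *)

theory Defs
  imports "HOL-Analysis.Analysis" "HOL-Algebra.Multiplicative_Group"
begin

definition general_linear_group :: "('a::field^'n^'n) monoid" where
  "general_linear_group = \<lparr>carrier = {A. invertible A}, monoid.mult = (**), one = mat 1\<rparr>"

definition scalar_matrices :: "('a::field^'n^'n) set" where
  "scalar_matrices = {mat c |c. c \<noteq> 0}"

definition PGL :: "('a::field^'n^'n) set monoid" where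
  "PGL = general_linear_group Mod scalar_matrices"

definition conjugate :: "('g, 'b) monoid_scheme \<Rightarrow> 'g \<Rightarrow> 'g \<Rightarrow> 'g" where
  "conjugate G h g = inv\<^bsub>G\<^esub> g \<otimes>\<^bsub>G\<^esub> h \<otimes>\<^bsub>G\<^esub> g"

(* This is the convention [x, y] = x^-1 y^-1 x y, not the x y x^-1 y^-1 underlying derived_set. *)
definition commutator :: "('g, 'b) monoid_scheme \<Rightarrow> 'g \<Rightarrow> 'g \<Rightarrow> 'g" where
  "commutator G x y = inv\<^bsub>G\<^esub> x \<otimes>\<^bsub>G\<^esub> inv\<^bsub>G\<^esub> y \<otimes>\<^bsub>G\<^esub> x \<otimes>\<^bsub>G\<^esub> y"

definition involution :: "('g, 'b) monoid_scheme \<Rightarrow> 'g \<Rightarrow> bool" where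
  "involution G x \<longleftrightarrow> x \<in> carrier G \<and> group.ord G x = 2"

lemma group_general_linear_group: "group (general_linear_group :: ('a::field^'n^'n) monoid)"
proof (rule groupI)
  fix A :: "'a^'n^'n"
  assume "A \<in> carrier general_linear_group"
  then obtain B where B: "A ** B = mat 1" "B ** A = mat 1"
    by (auto simp: general_linear_group_def invertible_def)
  then have "invertible B" by (auto simp: invertible_def)
  with B show "\<exists>B\<in>carrier general_linear_group.
      B \<otimes>\<^bsub>general_linear_group\<^esub> A = \<one>\<^bsub>general_linear_group\<^esub>"
    by (auto simp: general_linear_group_def)
next
  show "\<one>\<^bsub>general_linear_group\<^esub> \<in> carrier (general_linear_group :: ('a^'n^'n) monoid)"
    by (auto simp: general_linear_group_def invertible_def intro: exI[of _ "mat 1"])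
qed (simp_all add: general_linear_group_def matrix_mul_assoc invertible_mult)

lemma mat_mult: "mat c ** A = ((\<chi> i j. c * A $ i $ j) :: 'a::field^'n^'n)"
proof -
  have "(\<Sum>k\<in>UNIV. (if i = k then c else 0) * A $ k $ j) = c * A $ i $ j" for i j
    by (subst sum.remove[of _ i]) (auto intro: sum.neutral)
  then show ?thesis by (simp add: matrix_matrix_mult_def mat_def)
qed

lemma mult_mat: "A ** mat c = ((\<chi> i j. c * A $ i $ j) :: 'a::field^'n^'n)"
proof -
  have "(\<Sum>k\<in>UNIV. A $ i $ k * (if k = j then c else 0)) = c * A $ i $ j" for i j
    by (subst sum.remove[of _ j]) (auto intro: sum.neutral simp: mult.commute)
  then show ?thesis by (simp add: matrix_matrix_mult_def mat_def)
qed

lemma mat_mult_mat: "mat c ** mat d = (mat (c * d) :: 'a::field^'n^'n)"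
  by (simp add: mat_mult) (simp add: mat_def vec_eq_iff)

lemma mat_mult_commute: "mat c ** A = A ** mat c" for A :: "'a::field^'n^'n"
  by (simp add: mat_mult mult_mat)

lemma normal_scalar_matrices:
  "(scalar_matrices :: ('a::field^'n^'n) set) \<lhd> general_linear_group"
proof -
  let ?GL = "general_linear_group :: ('a^'n^'n) monoid"
  interpret group ?GL by (rule group_general_linear_group)
  have inv_mat: "invertible (mat c :: 'a^'n^'n)" if "c \<noteq> 0" for c :: 'a
    using that by (auto simp: invertible_def mat_mult_mat intro!: exI[of _ "mat (inverse c)"])
  have sub: "scalar_matrices \<subseteq> carrier ?GL"
    by (auto simp: scalar_matrices_def general_linear_group_def inv_mat)
  have "subgroup scalar_matrices ?GL"
  proof (rule subgroupI)
    show "scalar_matrices \<noteq> ({} :: ('a^'n^'n) set)"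
      by (auto simp: scalar_matrices_def intro: exI[of _ 1])
    fix A B :: "'a^'n^'n" assume A: "A \<in> scalar_matrices"
    then obtain c where c: "A = mat c" "c \<noteq> 0" by (auto simp: scalar_matrices_def)
    have "inv\<^bsub>?GL\<^esub> A = mat (inverse c)"
      using c inv_mat[of "inverse c"] inv_mat[of c]
      by (intro inv_equality) (auto simp: general_linear_group_def mat_mult_mat)
    with c show "inv\<^bsub>?GL\<^esub> A \<in> scalar_matrices" by (auto simp: scalar_matrices_def)
    assume "B \<in> scalar_matrices"
    with c show "A \<otimes>\<^bsub>?GL\<^esub> B \<in> scalar_matrices"
      by (auto simp: scalar_matrices_def general_linear_group_def mat_mult_mat)
  qed (rule sub)
  moreover have "A \<otimes>\<^bsub>?GL\<^esub> S \<otimes>\<^bsub>?GL\<^esub> inv\<^bsub>?GL\<^esub> A = S"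
    if "A \<in> carrier ?GL" "S \<in> scalar_matrices" for A S
  proof -
    have "A \<otimes>\<^bsub>?GL\<^esub> S = S \<otimes>\<^bsub>?GL\<^esub> A"
      using that(2) by (auto simp: scalar_matrices_def general_linear_group_def mat_mult_commute)
    with that sub show ?thesis by (simp add: inv_solve_right' subsetD)
  qed
  ultimately show ?thesis by (simp add: normal_inv_iff)
qed

lemma group_PGL: "group (PGL :: ('a::field^'n^'n) set monoid)"
  unfolding PGL_def by (rule normal.factorgroup_is_group[OF normal_scalar_matrices])

end

theory Submission imports Defs
begin

text \<open>
  Square roots exist in a finite field of characteristic two, so every element of PGL(2,q) is the image
  of a matrix of determinant one. Let h and its conjugate lift to such matrices X and Z; they have
  the same trace. In characteristic two the trace of the commutator of X and Z is the square of the
  trace of W = XZ, and a noncentral matrix of determinant one and trace zero is an involution. This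
  settles the case tr W = 0. If tr W is nonzero, then W raised to the power q is W or its inverse,
  so V = W^k satisfies V^2 = W^(-1), and by Cayley-Hamilton
  tr(V) V X = (V^2 + 1) X = Z^(-1) + X = Z + X + tr(X). This has trace zero, and it is central only
  if X and Z commute.
\<close>

section \<open>Finite fields of even order\<close>

text \<open>Translation by 1 permutes the field, so summing \<open>x + 1\<close> over all
  \<open>x\<close> shows that the number of elements is zero in the field; a power of two vanishes
  there only if 2 does.\<close>

lemma two_eq_0_if_card_power_2:
  assumes "CARD('a::{field,finite}) = 2 ^ n"
  shows "(2::'a) = 0"
proof -
  have "(\<Sum>x\<in>(UNIV::'a set). x + 1) = (\<Sum>x\<in>UNIV. x)"
    by (rule sum.reindex_bij_witness[of _ "\<lambda>x. x - 1" "\<lambda>x. x + 1"]) auto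
  then have "of_nat CARD('a) = (0::'a)"
    by (simp add: sum.distrib)
  then show ?thesis by (simp add: assms)
qed

text \<open>
  The library has this for the class \<open>finite_field\<close>, but the sort \<open>{field,finite}\<close> is not below that
  class.
\<close>
lemma power_card_field_eq_same:
  fixes x :: "'a::{field,finite}"
  shows "x ^ CARD('a) = x"
proof (cases "x = 0")
  case False
  \<comment> \<open>Multiplication by \<open>x\<close> permutes the nonzero elements; cancelling
    their product leaves x^(q-1) = 1.\<close>
  have "(\<Prod>y\<in>-{0}. x * y) = (\<Prod>y\<in>-{0}. y)"
    by (rule prod.reindex_bij_witness[of _ "\<lambda>y. y / x" "\<lambda>y. x * y"]) (use False in auto)
  moreover have "(\<Prod>y\<in>-{0::'a}. y) \<noteq> 0"
    by simp
  ultimately have "x ^ card (-{0::'a}) = 1"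
    by (simp add: prod.distrib)
  then have "x ^ (CARD('a) - 1) = 1"
    by (simp add: Compl_eq_Diff_UNIV card_Diff_singleton)
  then have "x ^ Suc (CARD('a) - 1) = x"
    unfolding power_Suc by simp
  moreover have "Suc (CARD('a) - 1) = CARD('a)"
    using zero_less_card_finite[where 'a = 'a] by linarith
  ultimately show ?thesis by metis
qed simp

text \<open>The root is x^(q/2), whose square is x^q = x.\<close>

lemma ex_square_root_if_card_power_2:
  fixes x :: "'a::{field,finite}"
  assumes "CARD('a) = 2 ^ n" and "n > 0"
  shows "\<exists>y. x = y * y"
proof
  have "2 ^ n = 2 ^ (n - 1) + (2 ^ (n - 1) :: nat)"
    using assms(2) by (cases n) auto
  then show "x = x ^ 2 ^ (n - 1) * x ^ 2 ^ (n - 1)"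
    using power_card_field_eq_same[of x] assms(1) by (simp flip: power_add)
qed

section \<open>Two by two matrices\<close>

lemma matrix_add_rdistrib: "(A + B) ** C = A ** C + B ** C"
  by (simp add: matrix_matrix_mult_def vec_eq_iff distrib_right sum.distrib)

lemma matrix_diff_ldistrib: "A ** (B - C) = A ** B - A ** C" for A :: "'a::ring_1^'n^'m"
  by (simp add: matrix_matrix_mult_def vec_eq_iff right_diff_distrib sum_subtractf)

lemma matrix_diff_rdistrib: "(A - B) ** C = A ** C - B ** C" for A :: "'a::ring_1^'n^'m"
  by (simp add: matrix_matrix_mult_def vec_eq_iff left_diff_distrib sum_subtractf)

text \<open>The classical adjugate in dimension two: it needs no division, and it is the inverse
  when the determinant is one.\<close>

definition adjugate2 :: "'a::comm_ring_1^2^2 \<Rightarrow> 'a^2^2" where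
  "adjugate2 A = mat (trace A) - A"

lemmas matrix2_simps = adjugate2_def trace_def det_2 matrix_matrix_mult_def mat_def sum_2
  vec_eq_iff forall_2

lemma mult_adjugate2: "A ** adjugate2 A = mat (det A)"
  and adjugate2_mult: "adjugate2 A ** A = mat (det A)"
  for A :: "'a::comm_ring_1^2^2"
  by (simp_all add: matrix2_simps algebra_simps)

lemma adjugate2_adjugate2 [simp]: "adjugate2 (adjugate2 A) = A" for A :: "'a::comm_ring_1^2^2"
  by (simp add: matrix2_simps algebra_simps)

lemma adjugate2_matrix_mult: "adjugate2 (A ** B) = adjugate2 B ** adjugate2 A"
  for A B :: "'a::comm_ring_1^2^2"
  by (simp add: matrix2_simps algebra_simps)

lemma det_adjugate2 [simp]: "det (adjugate2 A) = det A" for A :: "'a::comm_ring_1^2^2"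
  by (simp add: matrix2_simps algebra_simps)

lemma trace_adjugate2 [simp]: "trace (adjugate2 A) = trace A" for A :: "'a::comm_ring_1^2^2"
  by (simp add: matrix2_simps algebra_simps)

lemma cayley_hamilton2: "A ** A = mat (trace A) ** A - mat (det A)" for A :: "'a::comm_ring_1^2^2"
  by (simp add: matrix2_simps algebra_simps)

lemma trace_square2: "trace (A ** A) = trace A * trace A - 2 * det A" for A :: "'a::comm_ring_1^2^2"
  by (simp add: matrix2_simps algebra_simps)

lemma det_add_mat2: "det (A + mat c) = det A + c * trace A + c * c" for A :: "'a::comm_ring_1^2^2"
  by (simp add: matrix2_simps algebra_simps)

lemma trace_linear2: "trace (mat a ** A + mat b) = a * trace A + 2 * b"
  for A :: "'a::comm_ring_1^2^2"
  by (simp add: matrix2_simps algebra_simps)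

lemma trace_mat_mult2: "trace (mat a ** A) = a * trace A" for A :: "'a::comm_ring_1^2^2"
  by (simp add: matrix2_simps algebra_simps)

lemma det_mat_mult2: "det (mat a ** A) = a * a * det A" for A :: "'a::comm_ring_1^2^2"
  by (simp add: matrix2_simps algebra_simps)

text \<open>Fricke's trace identity, with determinants inserted to make it a polynomial identity
  valid for all matrices.\<close>

lemma trace_commutator2:
  "trace (adjugate2 A ** adjugate2 B ** A ** B) =
    det B * (trace A)\<^sup>2 + det A * (trace B)\<^sup>2 + (trace (A ** B))\<^sup>2
    - trace A * trace B * trace (A ** B) - 2 * det A * det B"
  for A B :: "'a::comm_ring_1^2^2"
  by (simp add: matrix2_simps algebra_simps power2_eq_square)

section \<open>The general linear group and its central quotient\<close>

interpretation GL: group "general_linear_group :: ('a::field^'n^'n) monoid"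
  by (rule group_general_linear_group)

interpretation PGL: group "PGL :: ('a::field^'n^'n) set monoid"
  by (rule group_PGL)

abbreviation to_PGL :: "'a::field^'n^'n \<Rightarrow> ('a^'n^'n) set" where
  "to_PGL A \<equiv> scalar_matrices #>\<^bsub>general_linear_group\<^esub> A"

interpretation to_PGL: group_hom "general_linear_group :: ('a::field^'n^'n) monoid" PGL to_PGL
proof unfold_locales
  show "to_PGL \<in> hom (general_linear_group :: ('a^'n^'n) monoid) PGL"
    unfolding PGL_def by (rule normal.r_coset_hom_Mod[OF normal_scalar_matrices])
qed

lemma carrier_GL [simp]: "A \<in> carrier general_linear_group \<longleftrightarrow> det A \<noteq> 0"
  for A :: "'a::field^'n^'n"
  by (simp add: general_linear_group_def invertible_det_nz)

lemma mult_GL [simp]: "A \<otimes>\<^bsub>general_linear_group\<^esub> B = A ** B"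
  by (simp add: general_linear_group_def)

lemma one_GL [simp]: "\<one>\<^bsub>general_linear_group\<^esub> = mat 1"
  by (simp add: general_linear_group_def)

lemma det_pow_GL [simp]: "det (A [^]\<^bsub>general_linear_group\<^esub> (m::nat)) = det A ^ m"
  for A :: "'a::field^'n^'n"
  by (induction m) (simp_all add: det_mul)

lemma inv_GL2:
  fixes A :: "'a::field^2^2"
  assumes "det A = 1"
  shows "inv\<^bsub>general_linear_group\<^esub> A = adjugate2 A"
  using assms by (intro GL.inv_equality) (simp_all add: adjugate2_mult)

lemma to_PGL_eq_one_iff:
  fixes A :: "'a::field^'n^'n"
  assumes "det A \<noteq> 0"
  shows "to_PGL A = \<one>\<^bsub>PGL\<^esub> \<longleftrightarrow> A \<in> scalar_matrices"
proof -
  have sub: "subgroup (scalar_matrices :: ('a^'n^'n) set) general_linear_group"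
    using normal_scalar_matrices by (rule normal_imp_subgroup)
  have "\<one>\<^bsub>PGL\<^esub> = (scalar_matrices :: ('a^'n^'n) set)"
    by (simp add: PGL_def)
  then show ?thesis
    using GL.coset_join1[of scalar_matrices A] GL.coset_join2[of A scalar_matrices] sub assms
    by (auto simp: subgroup.subset)
qed

lemma carrier_PGL_E:
  fixes x :: "('a::field^'n^'n) set"
  assumes "x \<in> carrier PGL"
  obtains A :: "'a^'n^'n" where "det A \<noteq> 0" and "x = to_PGL A"
  using assms by (auto simp: PGL_def FactGroup_def RCOSETS_def)

lemma carrier_PGL2_E:
  fixes x :: "('a::{field,finite}^2^2) set"
  assumes "x \<in> carrier PGL"
    and "CARD('a) = 2 ^ n" and "n > 0"
  obtains A :: "'a^2^2" where "det A = 1" and "x = to_PGL A"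
proof -
  obtain A :: "'a^2^2" where A: "det A \<noteq> 0" "x = to_PGL A"
    using assms(1) by (rule carrier_PGL_E)
  \<comment> \<open>Scaling a two by two matrix by \<open>c\<close> multiplies its determinant by
    \<open>c * c\<close>.\<close>
  obtain c where c: "inverse (det A) = c * c"
    using ex_square_root_if_card_power_2[OF assms(2,3)] by blast
  with A(1) have "c \<noteq> 0" by auto
  then have scalar: "mat c \<in> (scalar_matrices :: ('a^2^2) set)" "det (mat c :: 'a^2^2) \<noteq> 0"
    by (auto simp: scalar_matrices_def det_2 mat_def)
  have "det (mat c ** A) = 1"
    using A(1) by (simp add: det_mat_mult2 flip: c)
  moreover have "to_PGL (mat c ** A) = x"
  proof -
    have "to_PGL (mat c :: 'a^2^2) = \<one>\<^bsub>PGL\<^esub>"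
      using scalar by (subst to_PGL_eq_one_iff)
    then show ?thesis
      using to_PGL.hom_mult[of "mat c" A] scalar(2) A by simp
  qed
  ultimately show ?thesis using that by metis
qed

lemma (in group) involutionI:
  assumes "x \<in> carrier G" and "x \<otimes> x = \<one>" and "x \<noteq> \<one>"
  shows "involution G x"
proof -
  have "x [^] (2::nat) = \<one>"
    using assms by (simp add: numeral_2_eq_2)
  then have "ord x dvd 2"
    using assms(1) pow_eq_id by blast
  moreover have "ord x \<noteq> 1"
    using assms(1,3) ord_eq_1 by blast
  ultimately show ?thesis
    using assms(1) prime_nat_iff[of 2] two_is_prime_nat by (auto simp: involution_def)
qed

section \<open>Matrices of determinant one in characteristic two\<close>

text \<open>By Cayley-Hamilton the square of \<open>A\<close> is the scalar \<open>mat (-1)\<close>,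
  which is trivial in the quotient.\<close>

lemma involution_to_PGL:
  fixes A :: "'a::field^2^2"
  assumes "(2::'a) = 0" and "det A = 1" and "trace A = 0" and "to_PGL A \<noteq> \<one>\<^bsub>PGL\<^esub>"
  shows "involution PGL (to_PGL A)"
proof (rule PGL.involutionI)
  have "A ** A = mat (-1)"
    using assms(2,3) cayley_hamilton2[of A] by (simp add: matrix2_simps)
  then have "A ** A \<in> scalar_matrices"
    by (auto simp: scalar_matrices_def)
  then have "to_PGL (A ** A) = \<one>\<^bsub>PGL\<^esub>"
    by (simp add: to_PGL_eq_one_iff det_mul assms(2))
  then show "to_PGL A \<otimes>\<^bsub>PGL\<^esub> to_PGL A = \<one>\<^bsub>PGL\<^esub>"
    using to_PGL.hom_mult[of A A] assms(2) by simp
qed (use assms in \<open>simp_all\<close>)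

text \<open>Cayley-Hamilton rewrites the square of \<open>A\<close> whenever it appears, so all
  powers stay in the span of \<open>A\<close> and the identity.\<close>

lemma pow_GL2_linear:
  fixes A :: "'a::field^2^2"
  shows "\<exists>a b. A [^]\<^bsub>general_linear_group\<^esub> (m::nat) = mat a ** A + mat b"
proof (induction m)
  case 0
  show ?case by (rule exI[of _ 0], rule exI[of _ 1]) (simp add: matrix2_simps)
next
  case (Suc m)
  then obtain a b where "A [^]\<^bsub>general_linear_group\<^esub> m = mat a ** A + mat b" by blast
  then have "A [^]\<^bsub>general_linear_group\<^esub> Suc m =
      mat (a * trace A + b) ** A + mat (- a * det A)"
    by (simp add: matrix2_simps algebra_simps)
  then show ?case by blast
qed

text \<open>In characteristic two the term \<open>2 * det A\<close> drops out of
  \<open>trace_square2\<close>, so the trace commutes with squaring; iterate.\<close>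

lemma trace_pow_GL2:
  fixes A :: "'a::field^2^2"
  assumes "(2::'a) = 0" and "det A = 1"
  shows "trace (A [^]\<^bsub>general_linear_group\<^esub> (2 ^ i :: nat)) = trace A ^ (2 ^ i)"
proof (induction i)
  case (Suc i)
  let ?B = "A [^]\<^bsub>general_linear_group\<^esub> (2 ^ i :: nat)"
  have "A [^]\<^bsub>general_linear_group\<^esub> (2 ^ Suc i :: nat) = ?B ** ?B"
    using GL.nat_pow_mult[of A "2 ^ i" "2 ^ i"] assms(2) by (simp add: mult_2)
  then show ?case
    by (simp add: trace_square2 assms(1) Suc.IH mult_2 power_add)
qed (use assms in \<open>simp add: GL.nat_pow_eone\<close>)

lemma adjugate2_char_2:
  fixes A :: "'a::comm_ring_1^2^2"
  assumes "(2::'a) = 0"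
  shows "adjugate2 A = A + mat (trace A)"
proof -
  have "- x = x" for x :: 'a
    using assms by (metis add.inverse_unique mult_2 mult_zero_left)
  then show ?thesis by (simp add: matrix2_simps)
qed

text \<open>
  The power of exponent q is a linear polynomial in A with the same trace and determinant as A.
\<close>
lemma pow_card_GL2:
  fixes A :: "'a::{field,finite}^2^2"
  assumes "CARD('a) = 2 ^ n" and "det A = 1" and "trace A \<noteq> 0"
  shows "A [^]\<^bsub>general_linear_group\<^esub> CARD('a) \<in> {A, adjugate2 A}"
proof -
  note two = two_eq_0_if_card_power_2[OF assms(1)]
  let ?B = "A [^]\<^bsub>general_linear_group\<^esub> CARD('a)"
  obtain a b where B: "?B = mat a ** A + mat b"
    using pow_GL2_linear by blast
  have "trace ?B = trace A"
    using trace_pow_GL2[OF two assms(2), of n] power_card_field_eq_same[of "trace A"] assms(1)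
    by simp
  \<comment> \<open>The contribution \<open>2 * b\<close> to the trace vanishes, so
    \<open>a * trace A = trace A\<close>.\<close>
  then have "a = 1"
    using assms(3) two by (simp add: B trace_linear2)
  then have B': "?B = A + mat b"
    using B by simp
  have "det ?B = 1"
    by (simp add: assms(2))
  \<comment> \<open>Equate 1 with the determinant of \<open>A + mat b\<close>; the two roots in
    \<open>b\<close> yield \<open>A\<close> and its adjugate.\<close>
  then have "b * (trace A + b) = 0"
    by (simp add: B' det_add_mat2 assms(2) algebra_simps)
  then have "b = 0 \<or> b = - trace A"
    by (auto simp: add_eq_0_iff)
  moreover have "- trace A = trace A"
    using two by (metis add.inverse_unique mult_2 mult_zero_left)
  ultimately show ?thesis
    by (auto simp: B' adjugate2_char_2[OF two])
qed

text \<open>The q-th power map fixes or inverts \<open>A\<close>, and inversion commutes with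
  powers, so applying it twice returns \<open>A\<close>. Trace zero must be excluded: there
  \<open>A\<close> squares to 1, while the exponent is odd.\<close>

lemma pow_card_square_GL2:
  fixes A :: "'a::{field,finite}^2^2"
  assumes "CARD('a) = 2 ^ n" and "det A = 1" and "trace A \<noteq> 0"
  shows "A [^]\<^bsub>general_linear_group\<^esub> ((CARD('a))\<^sup>2 - 1) = mat 1"
proof -
  let ?G = "general_linear_group :: ('a^2^2) monoid"
  let ?q = "CARD('a)"
  have A: "A \<in> carrier ?G" using assms(2) by simp
  have "A [^]\<^bsub>?G\<^esub> (?q\<^sup>2) = (A [^]\<^bsub>?G\<^esub> ?q) [^]\<^bsub>?G\<^esub> ?q"
    using GL.nat_pow_pow[OF A, of ?q ?q] by (simp add: power2_eq_square)
  also have "\<dots> = A"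
  proof (cases "A [^]\<^bsub>?G\<^esub> ?q = A")
    case False
    then have q: "A [^]\<^bsub>?G\<^esub> ?q = adjugate2 A"
      using pow_card_GL2[OF assms] by blast
    moreover have "adjugate2 A [^]\<^bsub>?G\<^esub> ?q = adjugate2 (A [^]\<^bsub>?G\<^esub> ?q)"
      using GL.nat_pow_inv[OF A, of ?q] by (simp add: inv_GL2 assms(2))
    ultimately show ?thesis by simp
  qed simp
  finally have "A [^]\<^bsub>?G\<^esub> (?q\<^sup>2) = A" .
  moreover have "?q\<^sup>2 = Suc (?q\<^sup>2 - 1)" by simp
  ultimately have "A [^]\<^bsub>?G\<^esub> (?q\<^sup>2 - 1) \<otimes>\<^bsub>?G\<^esub> A = A"
    by (metis GL.nat_pow_Suc)
  then show ?thesis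
    using GL.r_cancel_one[of A "A [^]\<^bsub>?G\<^esub> (?q\<^sup>2 - 1)"] A by simp
qed

text \<open>Multiply Cayley-Hamilton for \<open>V\<close> by \<open>X\<close> on the right. Up to
  the factor \<open>trace V\<close>, this turns \<open>V ** X\<close> into a sum free of
  \<open>V\<close>, whose trace and centrality can be read off.\<close>

lemma trace_inverse_root_mult:
  fixes V X Z :: "'a::field^2^2"
  assumes "V ** V = adjugate2 (X ** Z)" and "det V = 1" and "det X = 1"
  shows "mat (trace V) ** (V ** X) = adjugate2 Z + X"
proof -
  have "mat (trace V) ** V = V ** V + mat 1"
    using cayley_hamilton2[of V] assms(2) by simp
  then have "mat (trace V) ** (V ** X) = (adjugate2 Z ** adjugate2 X + mat 1) ** X"
    by (simp add: assms(1) adjugate2_matrix_mult matrix_mul_assoc)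
  also have "\<dots> = adjugate2 Z ** (adjugate2 X ** X) + X"
    by (simp add: matrix_add_rdistrib matrix_mul_assoc)
  finally show ?thesis by (simp add: adjugate2_mult assms(3))
qed

theorem proposition4:
  fixes G :: "('a::{field,finite}^2^2) set monoid" (structure)
    and q n k :: nat
    and h g :: "('a^2^2) set"
  assumes "CARD('a) = q" and "q = 2 ^ n" and "q > 2"
    and "G = PGL"
    and "2 * k + 1 = q\<^sup>2 - 1"
    and "h \<in> carrier G" and "h \<noteq> \<one>" and "odd (group.ord G h)"
    and "g \<in> carrier G"
    and "commutator G h (conjugate G h g) \<noteq> \<one>"
  shows "involution G (commutator G h (conjugate G h g)) \<or>
    involution G ((h \<otimes> conjugate G h g) [^] k \<otimes> h)"
proof -
  let ?GL = "general_linear_group :: ('a^2^2) monoid"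
  have card: "CARD('a) = 2 ^ n" and n: "n > 0"
    using assms(1-3) by (auto intro: Nat.gr0I)
  note two = two_eq_0_if_card_power_2[OF card]
  have double: "x + x = 0" for x :: 'a
    using two by (metis mult_2 mult_zero_left)
  obtain X where X: "det X = 1" "h = to_PGL X"
    using carrier_PGL2_E[OF _ card n] assms(4,6) by metis
  obtain Y where Y: "det Y = 1" "g = to_PGL Y"
    using carrier_PGL2_E[OF _ card n] assms(4,9) by metis
  \<comment> \<open>Lifts of determinant one: \<open>Z\<close> of the conjugate of \<open>h\<close>,
    \<open>W\<close> of the product, \<open>V\<close> of its k-th power, \<open>C\<close> of the
    commutator.\<close>
  define Z where "Z = adjugate2 Y ** X ** Y"
  define W where "W = X ** Z"
  define V where "V = W [^]\<^bsub>?GL\<^esub> k"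
  define C where "C = adjugate2 X ** adjugate2 Z ** X ** Z"
  have det_Z: "det Z = 1" and det_W: "det W = 1" and det_C: "det C = 1" and det_V: "det V = 1"
    by (simp_all add: Z_def W_def C_def V_def det_mul X Y)
  have "trace Z = trace (Y ** adjugate2 Y ** X)"
    unfolding Z_def by (metis matrix_mul_assoc trace_mul_sym)
  then have trace_Z: "trace Z = trace X"
    by (simp add: mult_adjugate2 Y)
  have inv: "inv\<^bsub>PGL\<^esub> (to_PGL A) = to_PGL (adjugate2 A)" if "det A = 1" for A :: "'a^2^2"
    using that by (simp add: inv_GL2 flip: to_PGL.hom_inv)
  have mult: "to_PGL A \<otimes>\<^bsub>PGL\<^esub> to_PGL B = to_PGL (A ** B)" if "det A = 1" "det B = 1"
    for A B :: "'a^2^2"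
    using that to_PGL.hom_mult[of A B] by simp
  have conj: "conjugate G h g = to_PGL Z"
    by (simp add: conjugate_def assms(4) X Y inv mult det_mul Z_def)
  have comm: "commutator G h (conjugate G h g) = to_PGL C"
    by (simp add: commutator_def conj) (simp add: assms(4) X det_Z inv mult det_mul C_def)
  have power: "(h \<otimes> conjugate G h g) [^] k \<otimes> h = to_PGL (V ** X)"
    by (simp add: conj)
      (simp add: assms(4) X det_Z det_W det_V mult V_def flip: W_def to_PGL.hom_nat_pow)
  have C_nontrivial: "to_PGL C \<noteq> \<one>\<^bsub>PGL\<^esub>"
    using assms(4,10) comm by simp
  show ?thesis
  proof (cases "trace W = 0")
    case True
    \<comment> \<open>With t the common trace of \<open>X\<close> and \<open>Z\<close> and w =
      \<open>trace W\<close>, Fricke's identity in characteristic two reads tr C = w^2 + t^2 w, in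
      general not w^2 alone; it vanishes at w = 0.\<close>
    have "trace C = 0"
      using True trace_commutator2[of X Z]
      by (simp add: C_def X det_Z trace_Z two double flip: W_def)
    then have "involution PGL (to_PGL C)"
      using two det_C C_nontrivial by (intro involution_to_PGL)
    then show ?thesis unfolding comm by (simp add: assms(4))
  next
    case False
    have W: "W \<in> carrier ?GL" and V: "V \<in> carrier ?GL"
      using det_W det_V by simp_all
    \<comment> \<open>The exponent is q^2 - 1, which kills \<open>W\<close>; hence \<open>V\<close>
      is a square root of the inverse of \<open>W\<close>.\<close>
    have "V \<otimes>\<^bsub>?GL\<^esub> V \<otimes>\<^bsub>?GL\<^esub> W = W [^]\<^bsub>?GL\<^esub> (k + k + 1)"
      using W by (simp only: V_def GL.nat_pow_mult GL.nat_pow_Suc Suc_eq_plus1[symmetric])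
    also have "\<dots> = mat 1"
      using pow_card_square_GL2[OF card det_W False] assms(1,5) by (simp add: mult_2)
    finally have "inv\<^bsub>?GL\<^esub> W = V \<otimes>\<^bsub>?GL\<^esub> V"
      using W V by (intro GL.inv_equality) (simp_all add: det_mul)
    then have VV: "V ** V = adjugate2 W"
      by (simp add: inv_GL2 det_W)
    \<comment> \<open>The adjugate preserves the trace. Thus \<open>trace V\<close> is nonzero and
      can be cancelled below.\<close>
    then have "trace V * trace V = trace W"
      using trace_square2[of V] two by simp
    with False have trace_V: "trace V \<noteq> 0" by auto
    have VX: "mat (trace V) ** (V ** X) = adjugate2 Z + X"
      using VV det_V X(1) unfolding W_def by (rule trace_inverse_root_mult)
    then have "trace V * trace (V ** X) = trace X + trace X"
      by (metis trace_mat_mult2 trace_add trace_adjugate2 trace_Z)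
    with trace_V have "trace (V ** X) = 0"
      by (simp add: double)
    moreover have "to_PGL (V ** X) \<noteq> \<one>\<^bsub>PGL\<^esub>"
    proof
      assume "to_PGL (V ** X) = \<one>\<^bsub>PGL\<^esub>"
      then have "V ** X \<in> scalar_matrices"
        by (simp add: to_PGL_eq_one_iff det_mul det_V X)
      then obtain c where "V ** X = mat c"
        by (auto simp: scalar_matrices_def)
      \<comment> \<open>If \<open>V ** X\<close> were scalar, \<open>X\<close> would be a polynomial
        in \<open>Z\<close> and so commute with it, making the commutator trivial.\<close>
      then have "X = mat (trace V * c) - adjugate2 Z"
        using VX by (simp add: mat_mult_mat)
      then have "X ** Z = Z ** X"
        by (simp add: matrix_diff_ldistrib matrix_diff_rdistrib mult_adjugate2 adjugate2_mult
            mat_mult_commute)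
      then have "C = adjugate2 X ** (adjugate2 Z ** Z) ** X"
        unfolding C_def by (metis matrix_mul_assoc)
      then have "C = mat 1"
        by (simp add: adjugate2_mult det_Z X)
      then show False
        using C_nontrivial by (metis to_PGL.hom_one one_GL)
    qed
    ultimately have "involution PGL (to_PGL (V ** X))"
      using two by (intro involution_to_PGL) (simp_all add: det_mul det_V X)
    then show ?thesis unfolding power by (simp add: assms(4))
  qed
qed

end
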